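(* Let $0<\alpha<1$, let $W(x)=\begin{pmatrix}|x|^\alpha&0\\0&|x|^{-\alpha}\end{pmatrix}$ for $x\in\mathbb{R}$ (a matrix $A_2$ weight on $\mathbb{R}$), and let $\mathscr{D}$ be the standard dyadic grid on $\mathbb{R}$. Then there exists a $2\times 2$ matrix function $B$ on $\mathbb{R}$, whose entries are scalar functions in $\mathrm{BMO}(\mathbb{R})$, such that the dyadic paraproduct $\pi_B$ with respect to $\mathscr{D}$ is not bounded on $L^2(W)$, and consequently $[T,B]$ is not bounded on $L^2(W)$, where $T$ is any of the Riesz transforms (on $\mathbb{R}$: the Hilbert transform, acting componentwise).
   Context: The standard dyadic grid on $\mathbb{R}$ is $\{[2^{-k}m,2^{-k}(m+1)):k,m\in\mathbb{Z}\}$. For an interval $I$ with left and right halves $I_\ell,I_r$, $h_I=|I|^{-1/2}(\chi_{I_\ell}-\chi_{I_r})$; $B_I=\int B\,h_I\,dx$ (entrywise); $m_I\vec f$ is the componentwise average of $\vec f$ over $I$. $\pi_B\vec f=\sum_{I\in\mathscr{D}}B_I(m_I\vec f)h_I$. $L^2(W)$ is the space of measurable $\vec f:\mathbb{R}\to\mathbb{C}^2$ with $\|\vec f\|_{L^2(W)}^2=\int_{\mathbb{R}}|W^{1/2}(x)\vec f(x)|^2\,dx<\infty$. $\mathrm{BMO}(\mathbb{R})$ is the classical John–Nirenberg space. $[T,B]\vec f=T(B\vec f)-B(T\vec f)$; it is bounded on $L^2(W)$ if $\|[T,B]\vec f\|_{L^2(W)}\le C\|\vec f\|_{L^2(W)}$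 for all bounded compactly supported measurable $\vec f$. *)

theory Defs
  imports "HOL-Analysis.Analysis"
begin

definition hermitian_psd :: "complex^'n^'n \<Rightarrow> bool" where
  "hermitian_psd A \<longleftrightarrow> (\<forall>i j. A $ i $ j = cnj (A $ j $ i)) \<and>
     (\<forall>v. 0 \<le> Re (\<Sum>i\<in>UNIV. (A *v v) $ i * cnj (v $ i)))"

definition hermitian_pd :: "complex^'n^'n \<Rightarrow> bool" where
  "hermitian_pd A \<longleftrightarrow> (\<forall>i j. A $ i $ j = cnj (A $ j $ i)) \<and>
     (\<forall>v. v \<noteq> 0 \<longrightarrow> 0 < Re (\<Sum>i\<in>UNIV. (A *v v) $ i * cnj (v $ i)))"

(* Well defined for positive semidefinite A, the only case in which it is used. *)
definition matrix_sqrt :: "complex^'n^'n \<Rightarrow> complex^'n^'n" where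
  "matrix_sqrt A = (THE S. hermitian_psd S \<and> S ** S = A)"

definition locally_integrable :: "(real \<Rightarrow> complex) \<Rightarrow> bool" where
  "locally_integrable f \<longleftrightarrow> (\<forall>a b. set_integrable lebesgue {a..b} f)"

definition average :: "real \<Rightarrow> real \<Rightarrow> (real \<Rightarrow> complex) \<Rightarrow> complex" where
  "average a b f = (LINT x:{a..b}|lebesgue. f x) / of_real (b - a)"

definition vec_average :: "real \<Rightarrow> real \<Rightarrow> (real \<Rightarrow> complex^'n) \<Rightarrow> complex^'n" where
  "vec_average a b f = (\<chi> i. average a b (\<lambda>x. f x $ i))"

definition mat_average :: "real \<Rightarrow> real \<Rightarrow> (real \<Rightarrow> complex^'n^'n) \<Rightarrow> complex^'n^'n" where
  "mat_average a b A = (\<chi> i j. average a b (\<lambda>x. A x $ i $ j))"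

definition matrix_weight :: "(real \<Rightarrow> complex^'n^'n) \<Rightarrow> bool" where
  "matrix_weight W \<longleftrightarrow> (AE x in lebesgue. hermitian_pd (W x)) \<and>
     (\<forall>i j. locally_integrable (\<lambda>x. W x $ i $ j))"

(* The Treil--Volberg condition
     sup_I || (m_I W)^(1/2) (m_I W^(-1))^(1/2) || < infinity,
   the supremum being over all bounded intervals and the norm the operator norm. *)
definition matrix_A2_weight :: "(real \<Rightarrow> complex^'n^'n) \<Rightarrow> bool" where
  "matrix_A2_weight W \<longleftrightarrow> matrix_weight W \<and> matrix_weight (\<lambda>x. matrix_inv (W x)) \<and>
     (\<exists>C. \<forall>a b. a < b \<longrightarrow>
        onorm (\<lambda>v. (matrix_sqrt (mat_average a b W)
                    ** matrix_sqrt (mat_average a b (\<lambda>x. matrix_inv (W x)))) *v v) \<le> C)"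

(* At the null set {0} the value is immaterial; there |0| powr (- \<alpha>) = 0. *)
definition power_weight :: "real \<Rightarrow> real \<Rightarrow> complex^2^2" where
  "power_weight \<alpha> x = vector [vector [of_real (\<bar>x\<bar> powr \<alpha>), 0],
                                vector [0, of_real (\<bar>x\<bar> powr (- \<alpha>))]]"

definition L2_norm_sq :: "(real \<Rightarrow> complex^'n) \<Rightarrow> ennreal" where
  "L2_norm_sq f = (\<integral>\<^sup>+x. ennreal ((norm (f x))\<^sup>2) \<partial>lebesgue)"

definition L2W_norm_sq :: "(real \<Rightarrow> complex^'n^'n) \<Rightarrow> (real \<Rightarrow> complex^'n) \<Rightarrow> ennreal" where
  "L2W_norm_sq W f = L2_norm_sq (\<lambda>x. matrix_sqrt (W x) *v f x)"

definition bounded_compactly_supported :: "(real \<Rightarrow> complex^'n) \<Rightarrow> bool" where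
  "bounded_compactly_supported f \<longleftrightarrow> f \<in> borel_measurable lebesgue \<and>
     bounded (range f) \<and> compact (closure {x. f x \<noteq> 0})"

(* ||T f|| <= C ||f||, written with squared norms because ennreal has no square root. *)
definition bounded_on_L2W ::
  "(real \<Rightarrow> complex^'n^'n) \<Rightarrow> ((real \<Rightarrow> complex^'n) \<Rightarrow> real \<Rightarrow> complex^'n) \<Rightarrow> bool" where
  "bounded_on_L2W W T \<longleftrightarrow> (\<exists>C::real. \<forall>f. bounded_compactly_supported f \<longrightarrow>
     L2W_norm_sq W (T f) \<le> ennreal (C\<^sup>2) * L2W_norm_sq W f)"

definition BMO :: "(real \<Rightarrow> complex) set" where
  "BMO = {f. locally_integrable f \<and> (\<exists>C::real. \<forall>a b. a < b \<longrightarrow>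
     (LINT x:{a..b}|lebesgue. cmod (f x - average a b f)) / (b - a) \<le> C)}"

(* The interval [a,b) is represented by the pair (a,b) of its endpoints. *)
definition dyadic_grid :: "(real \<times> real) set" where
  "dyadic_grid =
     {(2 powi (- k) * of_int m, 2 powi (- k) * (of_int m + 1)) | k m :: int. True}"

definition haar :: "real \<Rightarrow> real \<Rightarrow> real \<Rightarrow> real" where
  "haar a b x =
     (indicator {a..<(a + b) / 2} x - indicator {(a + b) / 2..<b} x) / sqrt (b - a)"

definition haar_coeff :: "(real \<Rightarrow> complex^'n^'n) \<Rightarrow> real \<Rightarrow> real \<Rightarrow> complex^'n^'n" where
  "haar_coeff B a b = (\<chi> i j. LINT x|lebesgue. B x $ i $ j * of_real (haar a b x))"

definition paraproduct_sums ::
  "(real \<Rightarrow> complex^'n^'n) \<Rightarrow> (real \<Rightarrow> complex^'n) \<Rightarrow> (real \<Rightarrow> complex^'n) \<Rightarrow> bool" where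
  "paraproduct_sums B f g \<longleftrightarrow> g \<in> borel_measurable lebesgue \<and>
     ((\<lambda>F. L2_norm_sq (\<lambda>x. g x -
          (\<Sum>(a, b)\<in>F. haar a b x *\<^sub>R (haar_coeff B a b *v vec_average a b f)))) \<longlongrightarrow> 0)
       (finite_subsets_at_top dyadic_grid)"

(* The series is summed unconditionally in unweighted L^2.  For B with entries in BMO and f
   bounded with compact support it converges there, and the sum is unique up to a null set. *)
definition paraproduct ::
  "(real \<Rightarrow> complex^'n^'n) \<Rightarrow> (real \<Rightarrow> complex^'n) \<Rightarrow> real \<Rightarrow> complex^'n" where
  "paraproduct B f = (SOME g. paraproduct_sums B f g)"

(* Principal value; the limit exists for almost every x if f is in L^2 with compact support. *)
definition hilbert_transform :: "(real \<Rightarrow> complex) \<Rightarrow> real \<Rightarrow> complex" where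
  "hilbert_transform f x = Lim (at_right 0)
     (\<lambda>\<epsilon>. of_real (1 / pi) * (LINT y:{y. \<epsilon> < \<bar>x - y\<bar>}|lebesgue. f y / of_real (x - y)))"

definition vec_hilbert_transform :: "(real \<Rightarrow> complex^'n) \<Rightarrow> real \<Rightarrow> complex^'n" where
  "vec_hilbert_transform f x = (\<chi> i. hilbert_transform (\<lambda>y. f y $ i) x)"

definition commutator ::
  "((real \<Rightarrow> complex^'n) \<Rightarrow> real \<Rightarrow> complex^'n) \<Rightarrow> (real \<Rightarrow> complex^'n^'n) \<Rightarrow>
    (real \<Rightarrow> complex^'n) \<Rightarrow> real \<Rightarrow> complex^'n" where
  "commutator T B f x = T (\<lambda>y. B y *v f y) x - B x *v T f x"

end

theory Submission
  imports Defs
begin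

text \<open>
  Because \<open>W\<close> is diagonal, a matrix symbol whose only nonzero entry \<open>b\<close> is in the lower left corner
  maps the first component of \<open>f\<close>, which is measured with the weight \<open>\<bar>x\<bar> powr \<alpha>\<close>, to the second
  component, which is measured with \<open>\<bar>x\<bar> powr (- \<alpha>)\<close>.  The operators in question thus become scalar
  operators from \<open>L\<^sup>2(\<bar>x\<bar> powr \<alpha>)\<close> to \<open>L\<^sup>2(\<bar>x\<bar> powr (- \<alpha>))\<close>.  Their boundedness would force
  \<open>b\<close> into a weighted BMO space, in which the oscillation over intervals of length \<open>\<delta>\<close> at the origin
  decays like \<open>\<delta> powr \<alpha>\<close>.  A function in BMO need not have this decay; even a bounded one
  can have oscillation bounded below at all scales.

  The choice made here is \<open>b = 1\<close> on the dyadic shells \<open>[2^j, 2^(j+1))\<close> with \<open>j\<close> even and \<open>b = 0\<close>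
  elsewhere.  At each scale \<open>\<delta> = 2^n\<close>, \<open>n\<close> odd, there is a test function of height at most 1 supported
  in \<open>[-2\<delta>, 2\<delta>]\<close> whose image has modulus at least a fixed \<open>c\<close> on the shell \<open>[\<delta>/2, \<delta>)\<close>.
  The squared norm of the input is of order at most \<open>\<delta> powr (1 + \<alpha>)\<close> and that of the output of
  order at least \<open>\<delta> powr (1 - \<alpha>)\<close>, and the ratio \<open>\<delta> powr (- 2 * \<alpha>)\<close> is unbounded as \<open>\<delta>\<close> tends
  to 0 (lemma \<open>not_bounded_on_L2W_power_weight\<close>).

  For the commutator the test function is the indicator of \<open>[-\<delta>, 0)\<close>: there \<open>b\<close> vanishes, so that
  only \<open>- b H f\<close> remains, and for \<open>x > 0\<close> the Hilbert transform is an integral without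
  singularity (\<open>commutator_unbounded\<close>).  For the paraproduct, the test function is taken to
  have mean zero on \<open>[0, 2\<delta>)\<close> and to vanish on \<open>[0, \<delta>/2)\<close>; since \<open>b\<close> is constant on dyadic intervals
  that do not touch the origin, the series then reduces to its term for \<open>[0, \<delta>)\<close>
  (\<open>paraproduct_unbounded\<close>).  Both arguments are direct; neither result is deduced from the other.

  The weight condition reduces, by commuting diagonal matrices, to the scalar fact that
  \<open>\<bar>x\<bar> powr \<alpha>\<close> is an \<open>A\<^sub>2\<close> weight (\<open>mean_powr_A2\<close>).
\<close>

section \<open>Diagonal matrices and their square roots\<close>

definition diag2 :: "real \<Rightarrow> real \<Rightarrow> complex^2^2" where
  "diag2 p q = vector [vector [of_real p, 0], vector [0, of_real q]]"

lemma diag2_nth [simp]: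
  "diag2 p q $ 1 $ 1 = of_real p" "diag2 p q $ 1 $ 2 = 0"
  "diag2 p q $ 2 $ 1 = 0" "diag2 p q $ 2 $ 2 = of_real q"
  by (simp_all add: diag2_def)

lemma power_weight_eq_diag2: "power_weight \<alpha> x = diag2 (\<bar>x\<bar> powr \<alpha>) (\<bar>x\<bar> powr (- \<alpha>))"
  by (simp add: power_weight_def diag2_def)

lemma diag2_mult_vec [simp]:
  "(diag2 p q *v v) $ 1 = of_real p * v $ 1" "(diag2 p q *v v) $ 2 = of_real q * v $ 2"
  by (simp_all add: matrix_vector_mult_def sum_2)

lemma diag2_mult: "diag2 p q ** diag2 r s = diag2 (p * r) (q * s)"
  by (simp add: matrix_matrix_mult_def vec_eq_iff forall_2 sum_2)

lemma matrix_inv_diag2: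
  assumes "p \<noteq> 0" "q \<noteq> 0"
  shows "matrix_inv (diag2 p q) = diag2 (inverse p) (inverse q)"
proof -
  have "diag2 1 1 = mat 1"
    by (simp add: vec_eq_iff forall_2 mat_def)
  then have r: "diag2 p q ** diag2 (inverse p) (inverse q) = mat 1"
    and l: "diag2 (inverse p) (inverse q) ** diag2 p q = mat 1"
    using assms by (simp_all add: diag2_mult)
  then have "diag2 p q ** matrix_inv (diag2 p q) = mat 1"
    unfolding matrix_inv_def by (rule someI2[where a = "diag2 (inverse p) (inverse q)", OF conjI]) auto
  then show ?thesis
    using l by (metis matrix_mul_assoc matrix_mul_lid matrix_mul_rid)
qed

lemma quadratic_form_diag2:
  "Re (\<Sum>i\<in>UNIV. (diag2 p q *v v) $ i * cnj (v $ i)) = p * (cmod (v $ 1))\<^sup>2 + q * (cmod (v $ 2))\<^sup>2"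
  by (simp add: sum_2 mult.assoc complex_norm_square[symmetric] flip: of_real_power)

lemma hermitian_psd_diag2:
  assumes "0 \<le> p" "0 \<le> q"
  shows "hermitian_psd (diag2 p q)"
  unfolding hermitian_psd_def quadratic_form_diag2 using assms by (simp add: forall_2)

lemma hermitian_pd_diag2:
  assumes "0 < p" "0 < q"
  shows "hermitian_pd (diag2 p q)"
proof -
  have "0 < p * (cmod (v $ 1))\<^sup>2 + q * (cmod (v $ 2))\<^sup>2" if "v \<noteq> 0" for v :: "complex^2"
  proof -
    have "v $ 1 \<noteq> 0 \<or> v $ 2 \<noteq> 0"
      using that by (simp add: vec_eq_iff forall_2)
    then show ?thesis
      using assms by (auto intro: add_pos_nonneg add_nonneg_pos)
  qed
  then show ?thesis
    unfolding hermitian_pd_def quadratic_form_diag2 by (simp add: forall_2)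
qed

text \<open>
  A Hermitian root \<open>S\<close> has off-diagonal equation \<open>t (s + u) = 0\<close>, where \<open>s, u \<ge> 0\<close> are its diagonal
  entries and \<open>t\<close> is the upper right one.  If \<open>t \<noteq> 0\<close>, then \<open>s = u = 0\<close>, and such an \<open>S\<close> is
  indefinite.  Hence \<open>S\<close> is diagonal.
\<close>

lemma matrix_sqrt_diag2:
  assumes "0 \<le> p" "0 \<le> q"
  shows "matrix_sqrt (diag2 p q) = diag2 (sqrt p) (sqrt q)"
  unfolding matrix_sqrt_def
proof (rule the_equality)
  show "hermitian_psd (diag2 (sqrt p) (sqrt q)) \<and> diag2 (sqrt p) (sqrt q) ** diag2 (sqrt p) (sqrt q) = diag2 p q"
    using assms by (simp add: hermitian_psd_diag2 diag2_mult)
next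
  fix S :: "complex^2^2"
  assume S: "hermitian_psd S \<and> S ** S = diag2 p q"
  define t where "t = S $ 1 $ 2"
  have herm: "S $ i $ j = cnj (S $ j $ i)" for i j
    using S unfolding hermitian_psd_def by blast
  obtain s u where s: "S $ 1 $ 1 = of_real s" and u: "S $ 2 $ 2 = of_real u"
    using herm[of 1 1] herm[of 2 2] by (metis Reals_cases Reals_cnj_iff)
  have t': "S $ 2 $ 1 = cnj t"
    unfolding t_def by (rule herm)
  have psd: "0 \<le> Re (\<Sum>i\<in>UNIV. (S *v v) $ i * cnj (v $ i))" for v
    using S unfolding hermitian_psd_def by blast
  have s0: "0 \<le> s"
    using psd[of "vector [1, 0]"] by (simp add: sum_2 matrix_vector_mult_def s u t')
  have u0: "0 \<le> u"
    using psd[of "vector [0, 1]"] by (simp add: sum_2 matrix_vector_mult_def s u t')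
  have sq: "S ** S = diag2 p q"
    using S by blast
  have off: "of_real s * t + t * of_real u = 0"
    using arg_cong[OF sq, of "\<lambda>A. A $ 1 $ 2"]
    by (simp add: matrix_matrix_mult_def sum_2 s u t_def)
  have "t = 0"
  proof (rule ccontr)
    assume t: "t \<noteq> 0"
    have "of_real (s + u) * t = 0"
      using off by (simp add: algebra_simps)
    then have "s + u = 0"
      using t by (metis mult_eq_0_iff of_real_eq_0_iff)
    then have "s = 0" "u = 0"
      using s0 u0 by auto
    \<comment> \<open>The form at \<open>(- t, 1)\<close> is \<open>- 2 \<bar>t\<bar>\<^sup>2\<close>.\<close>
    then have "0 \<le> - 2 * (cmod t)\<^sup>2"
      using psd[of "vector [- t, 1]"]
      by (simp add: sum_2 matrix_vector_mult_def s u t' t_def[symmetric] cmod_power2)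
        (simp add: power2_eq_square)
    then show False
      using t by simp
  qed
  moreover have "s * s = p"
    using arg_cong[OF sq, of "\<lambda>A. A $ 1 $ 1"] \<open>t = 0\<close>
    by (simp add: matrix_matrix_mult_def sum_2 s t_def[symmetric] flip: of_real_mult)
  moreover have "u * u = q"
    using arg_cong[OF sq, of "\<lambda>A. A $ 2 $ 2"] \<open>t = 0\<close>
    by (simp add: matrix_matrix_mult_def sum_2 u t_def[symmetric] flip: of_real_mult)
  ultimately show "S = diag2 (sqrt p) (sqrt q)"
    using s0 u0 s u t' t_def by (auto simp: vec_eq_iff forall_2)
qed

lemma norm_vec2: "(norm v)\<^sup>2 = (cmod (v $ 1))\<^sup>2 + (cmod (v $ 2))\<^sup>2" for v :: "complex^2"
  by (simp add: norm_vec_def L2_set_def sum_2)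

lemma norm_weighted:
  assumes "x \<noteq> 0"
  shows "(norm (matrix_sqrt (power_weight \<alpha> x) *v v))\<^sup>2
    = \<bar>x\<bar> powr \<alpha> * (cmod (v $ 1))\<^sup>2 + \<bar>x\<bar> powr (- \<alpha>) * (cmod (v $ 2))\<^sup>2"
  by (simp add: power_weight_eq_diag2 matrix_sqrt_diag2 norm_vec2 norm_mult power_mult_distrib)

section \<open>Power weights satisfy the matrix \<open>A\<^sub>2\<close> condition\<close>

lemma has_integral_abs_powr:
  fixes \<beta> M :: real
  assumes "- 1 < \<beta>" "0 \<le> M"
  shows "((\<lambda>x. \<bar>x\<bar> powr \<beta>) has_integral 2 * (M powr (\<beta> + 1) / (\<beta> + 1))) {- M..M}"
proof -
  have r: "((\<lambda>x. \<bar>x\<bar> powr \<beta>) has_integral M powr (\<beta> + 1) / (\<beta> + 1)) {0..M}"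
    using has_integral_powr_from_0[OF assms]
    by (rule has_integral_eq[rotated]) auto
  then have l: "((\<lambda>x. \<bar>x\<bar> powr \<beta>) has_integral M powr (\<beta> + 1) / (\<beta> + 1)) {- M..0}"
    using has_integral_reflect_real[where f = "\<lambda>x. \<bar>x\<bar> powr \<beta>" and a = 0 and b = M] by simp
  show ?thesis
    using has_integral_combine[OF _ _ l r] assms by simp
qed

lemma set_integrable_abs_powr:
  fixes \<beta> :: real
  assumes "- 1 < \<beta>"
  shows "set_integrable lebesgue {a..b} (\<lambda>x. \<bar>x\<bar> powr \<beta>)"
proof -
  define M where "M = max \<bar>a\<bar> \<bar>b\<bar>"
  have "set_integrable lebesgue {- M..M} (\<lambda>x. \<bar>x\<bar> powr \<beta>)"
    using has_integral_integrable[OF has_integral_abs_powr[OF assms, of M]]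
    by (intro nonnegative_absolutely_integrable_1) (auto simp: M_def)
  then show ?thesis
    by (rule set_integrable_subset) (auto simp: M_def)
qed

definition mean_powr :: "real \<Rightarrow> real \<Rightarrow> real \<Rightarrow> real" where
  "mean_powr a b \<beta> = (LINT x:{a..b}|lebesgue. \<bar>x\<bar> powr \<beta>) / (b - a)"

lemma mean_powr_nonneg: "a < b \<Longrightarrow> 0 \<le> mean_powr a b \<beta>"
  by (auto simp: mean_powr_def set_lebesgue_integral_def intro!: divide_nonneg_pos integral_nonneg_AE)

lemma mean_powr_le:
  assumes "- 1 < \<beta>" "a < b" and le: "\<And>x. a \<le> x \<Longrightarrow> x \<le> b \<Longrightarrow> \<bar>x\<bar> powr \<beta> \<le> K"
  shows "mean_powr a b \<beta> \<le> K"
proof -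
  have "(LINT x:{a..b}|lebesgue. \<bar>x\<bar> powr \<beta>) \<le> (LINT x:{a..b}|lebesgue. K)"
    using assms by (intro set_integral_mono set_integrable_abs_powr) auto
  then show ?thesis
    using \<open>a < b\<close> by (simp add: mean_powr_def field_simps set_lebesgue_integral_def)
qed

text \<open>
  Let \<open>M\<close> be the largest modulus of a point of the interval.  The mean of \<open>\<bar>x\<bar> powr \<alpha>\<close> is at most
  \<open>M powr \<alpha>\<close>, so the mean of \<open>\<bar>x\<bar> powr (- \<alpha>)\<close> must be compared with \<open>M powr (- \<alpha>)\<close>.  A long interval,
  of length at least \<open>M / 2\<close>, is compared with \<open>[-M, M]\<close>, where the integral is explicit; a shorter
  one stays at distance at least \<open>M / 2\<close> from the singularity.
\<close>

lemma mean_powr_A2: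
  fixes \<alpha> :: real
  assumes "0 < \<alpha>" "\<alpha> < 1" "a < b"
  shows "mean_powr a b \<alpha> * mean_powr a b (- \<alpha>) \<le> 4 / (1 - \<alpha>)"
proof -
  define M where "M = max \<bar>a\<bar> \<bar>b\<bar>"
  have M: "0 < M"
    using \<open>a < b\<close> by (auto simp: M_def)
  have pos: "mean_powr a b \<alpha> \<le> M powr \<alpha>"
    using assms by (intro mean_powr_le powr_mono2) (auto simp: M_def)
  have neg: "mean_powr a b (- \<alpha>) \<le> 4 / (1 - \<alpha>) * M powr (- \<alpha>)"
  proof (cases "M / 2 \<le> b - a")
    case True
    have "(LINT x:{a..b}|lebesgue. \<bar>x\<bar> powr (- \<alpha>)) \<le> (LINT x:{-M..M}|lebesgue. \<bar>x\<bar> powr (- \<alpha>))"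
      using set_integrable_abs_powr[of "- \<alpha>"] assms unfolding set_lebesgue_integral_def set_integrable_def
      by (intro integral_mono) (auto simp: M_def indicator_def)
    also have "\<dots> = integral {-M..M} (\<lambda>x. \<bar>x\<bar> powr (- \<alpha>))"
      using set_integrable_abs_powr[of "- \<alpha>"] assms by (intro set_lebesgue_integral_eq_integral) auto
    also have "\<dots> = 2 * (M powr (- \<alpha> + 1) / (- \<alpha> + 1))"
      using has_integral_abs_powr[of "- \<alpha>" M] assms M by (intro integral_unique) auto
    also have "\<dots> = 4 / (1 - \<alpha>) * M powr (- \<alpha>) * (M / 2)"
      using M assms by (simp add: powr_add[of M "- \<alpha>" 1, simplified]) (simp add: field_simps)
    also have "\<dots> \<le> 4 / (1 - \<alpha>) * M powr (- \<alpha>) * (b - a)"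
      using True assms by (intro mult_left_mono) auto
    finally show ?thesis
      using assms by (simp add: mean_powr_def pos_divide_le_eq)
  next
    case False
    show ?thesis
    proof (rule mean_powr_le)
      fix x assume "a \<le> x" "x \<le> b"
      then have "M / 2 \<le> \<bar>x\<bar>"
        using False unfolding M_def by linarith
      then have "\<bar>x\<bar> powr (- \<alpha>) \<le> (M / 2) powr (- \<alpha>)"
        using M assms by (intro powr_mono2') auto
      also have "\<dots> = 2 powr \<alpha> * M powr (- \<alpha>)"
        using M by (simp add: powr_divide powr_minus field_simps)
      also have "\<dots> \<le> 4 / (1 - \<alpha>) * M powr (- \<alpha>)"
      proof (rule mult_right_mono)
        have "2 powr \<alpha> \<le> 2 powr (1::real)"
          using assms by (intro powr_mono) auto
        also have "\<dots> \<le> 4 / (1 - \<alpha>)"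
          using assms by (simp add: field_simps)
        finally show "2 powr \<alpha> \<le> 4 / (1 - \<alpha>)" .
      qed simp
      finally show "\<bar>x\<bar> powr (- \<alpha>) \<le> 4 / (1 - \<alpha>) * M powr (- \<alpha>)" .
    qed (use assms in auto)
  qed
  have "mean_powr a b \<alpha> * mean_powr a b (- \<alpha>) \<le> M powr \<alpha> * (4 / (1 - \<alpha>) * M powr (- \<alpha>))"
    using pos neg mean_powr_nonneg[OF \<open>a < b\<close>] by (intro mult_mono) auto
  also have "\<dots> = 4 / (1 - \<alpha>)"
    using M by (simp add: powr_minus)
  finally show ?thesis .
qed

text \<open>
  The inverse of \<open>power_weight \<alpha> 0 = 0\<close> is an unspecified matrix, so the entries of
  the inverse weight are known only away from the origin.
\<close>

lemma average_cong_off_0: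
  assumes eq: "\<And>x. x \<noteq> 0 \<Longrightarrow> f x = g x" and g: "locally_integrable g"
  shows "locally_integrable f" and "average a b f = average a b g"
proof -
  define F where "F a b = (\<lambda>x. indicator {a..b} x *\<^sub>R f x)" for a b :: real
  define G where "G a b = (\<lambda>x. indicator {a..b} x *\<^sub>R g x)" for a b :: real
  have G: "integrable lebesgue (G a b)" for a b
    using g by (simp add: locally_integrable_def set_integrable_def G_def)
  then have Gm [measurable]: "G a b \<in> borel_measurable lebesgue" for a b
    by auto
  have "(\<lambda>x. if x \<in> {0} then F a b 0 else G a b x) \<in> borel_measurable lebesgue" for a b
    by (intro measurable_If_set) auto
  moreover have "F a b = (\<lambda>x. if x \<in> {0} then F a b 0 else G a b x)" for a b
    using eq by (auto simp: F_def G_def)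
  ultimately have Fm: "F a b \<in> borel_measurable lebesgue" for a b
    by simp
  have "AE x in lebesgue. x \<noteq> (0::real)"
    by (rule AE_I'[of "{0}"]) auto
  then have ae: "AE x in lebesgue. F a b x = G a b x" for a b
    by eventually_elim (auto simp: F_def G_def eq)
  show "locally_integrable f"
    using integrable_cong_AE[OF Fm Gm ae] G
    by (simp add: locally_integrable_def set_integrable_def F_def)
  show "average a b f = average a b g"
    using integral_cong_AE[OF Fm Gm ae]
    by (simp add: average_def set_lebesgue_integral_def F_def G_def)
qed

lemma locally_integrable_abs_powr:
  "- 1 < \<beta> \<Longrightarrow> locally_integrable (\<lambda>x. complex_of_real (\<bar>x\<bar> powr \<beta>))"
  using set_integrable_abs_powr[of \<beta>]
  by (simp add: locally_integrable_def set_integrable_def complex_of_real_integrable_eq scaleR_conv_of_real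
      flip: of_real_mult)

lemma average_abs_powr:
  "average a b (\<lambda>x. complex_of_real (\<bar>x\<bar> powr \<beta>)) = of_real (mean_powr a b \<beta>)"
  by (simp add: average_def mean_powr_def set_integral_complex_of_real)

lemma matrix_weight_diag_powr:
  assumes "\<bar>\<beta>\<bar> < 1" and V: "\<And>x. x \<noteq> 0 \<Longrightarrow> V x = diag2 (\<bar>x\<bar> powr \<beta>) (\<bar>x\<bar> powr (- \<beta>))"
  shows "matrix_weight V" and "mat_average a b V = diag2 (mean_powr a b \<beta>) (mean_powr a b (- \<beta>))"
proof -
  have z: "locally_integrable (\<lambda>x. 0)" "average a b (\<lambda>x. 0) = 0"
    by (simp_all add: locally_integrable_def set_integrable_def average_def set_lebesgue_integral_def)
  have p: "locally_integrable (\<lambda>x. complex_of_real (\<bar>x\<bar> powr \<beta>))"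
    and m: "locally_integrable (\<lambda>x. complex_of_real (\<bar>x\<bar> powr (- \<beta>)))"
    using assms(1) by (auto intro!: locally_integrable_abs_powr)
  have "AE x in lebesgue. x \<noteq> (0::real)"
    by (rule AE_I'[of "{0}"]) auto
  then have "AE x in lebesgue. hermitian_pd (V x)"
    by eventually_elim (auto simp: V intro!: hermitian_pd_diag2)
  moreover have "locally_integrable (\<lambda>x. V x $ i $ j)" for i j
    using exhaust_2[of i] exhaust_2[of j]
    by (auto intro: average_cong_off_0(1)[OF _ p] average_cong_off_0(1)[OF _ m] average_cong_off_0(1)[OF _ z(1)] simp: V)
  ultimately show "matrix_weight V"
    by (simp add: matrix_weight_def)
  have "average a b (\<lambda>x. V x $ 1 $ 1) = of_real (mean_powr a b \<beta>)"
    by (subst average_cong_off_0(2)[OF _ p]) (auto simp: V average_abs_powr)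
  moreover have "average a b (\<lambda>x. V x $ 2 $ 2) = of_real (mean_powr a b (- \<beta>))"
    by (subst average_cong_off_0(2)[OF _ m]) (auto simp: V average_abs_powr)
  moreover have "average a b (\<lambda>x. V x $ 1 $ 2) = 0" "average a b (\<lambda>x. V x $ 2 $ 1) = 0"
    by (subst average_cong_off_0(2)[OF _ z(1)]; auto simp: V z)+
  ultimately show "mat_average a b V = diag2 (mean_powr a b \<beta>) (mean_powr a b (- \<beta>))"
    by (simp add: mat_average_def vec_eq_iff forall_2)
qed

lemma matrix_A2_power_weight:
  assumes "0 < \<alpha>" "\<alpha> < 1"
  shows "matrix_A2_weight (power_weight \<alpha>)"
proof -
  have inv: "matrix_inv (power_weight \<alpha> x) = diag2 (\<bar>x\<bar> powr (- \<alpha>)) (\<bar>x\<bar> powr (- (- \<alpha>)))" if "x \<noteq> 0" for x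
    using that by (simp add: power_weight_eq_diag2 matrix_inv_diag2 powr_minus)
  have W: "matrix_weight (power_weight \<alpha>)"
    "mat_average a b (power_weight \<alpha>) = diag2 (mean_powr a b \<alpha>) (mean_powr a b (- \<alpha>))" for a b
    using matrix_weight_diag_powr[of \<alpha> "power_weight \<alpha>"] assms by (auto simp: power_weight_eq_diag2)
  have W': "matrix_weight (\<lambda>x. matrix_inv (power_weight \<alpha> x))"
    "mat_average a b (\<lambda>x. matrix_inv (power_weight \<alpha> x)) = diag2 (mean_powr a b (- \<alpha>)) (mean_powr a b \<alpha>)" for a b
    using matrix_weight_diag_powr[of "- \<alpha>", OF _ inv] assms by auto
  have "onorm (\<lambda>v. (matrix_sqrt (mat_average a b (power_weight \<alpha>))
      ** matrix_sqrt (mat_average a b (\<lambda>x. matrix_inv (power_weight \<alpha> x)))) *v v) \<le> sqrt (4 / (1 - \<alpha>))"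
    if "a < b" for a b
  proof (rule onorm_le)
    fix v :: "complex^2"
    \<comment> \<open>The two means are the same numbers in opposite order, so the product is a scalar matrix.\<close>
    define r where "r = sqrt (mean_powr a b \<alpha> * mean_powr a b (- \<alpha>))"
    have "matrix_sqrt (mat_average a b (power_weight \<alpha>))
        ** matrix_sqrt (mat_average a b (\<lambda>x. matrix_inv (power_weight \<alpha> x))) = diag2 r r"
      using mean_powr_nonneg[OF that]
      by (simp add: W W' matrix_sqrt_diag2 diag2_mult r_def real_sqrt_mult mult.commute)
    moreover have "diag2 r r *v v = r *\<^sub>R v"
      unfolding vec_eq_iff forall_2 by (simp add: scaleR_conv_of_real[where 'a = complex])
    moreover have "0 \<le> r" "r \<le> sqrt (4 / (1 - \<alpha>))"
      using mean_powr_A2[OF assms that] mean_powr_nonneg[OF that] unfolding r_def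
      by auto
    ultimately show "norm ((matrix_sqrt (mat_average a b (power_weight \<alpha>))
        ** matrix_sqrt (mat_average a b (\<lambda>x. matrix_inv (power_weight \<alpha> x)))) *v v)
      \<le> sqrt (4 / (1 - \<alpha>)) * norm v"
      by (simp add: mult_right_mono)
  qed
  then show ?thesis
    unfolding matrix_A2_weight_def using W(1) W'(1) by blast
qed

section \<open>A criterion for unboundedness\<close>

text \<open>
  The squared norm of the test function is at most \<open>(2\<delta>) powr \<alpha> * 4\<delta>\<close> and that of its image at least
  \<open>\<delta> powr (- \<alpha>) * c\<^sup>2 * \<delta> / 2\<close>, where \<open>\<delta> = 2 powi n\<close>.  A bound with constant \<open>C\<close> therefore gives
  \<open>c\<^sup>2 \<le> 8 * C\<^sup>2 * 2 powr \<alpha> * \<delta> powr (2 * \<alpha>)\<close>, which fails for small \<open>\<delta>\<close>.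
\<close>

lemma not_bounded_on_L2W_power_weight:
  fixes T :: "(real \<Rightarrow> complex^2) \<Rightarrow> real \<Rightarrow> complex^2"
  assumes "0 < \<alpha>" "0 < c"
    and test: "\<And>n::int. odd n \<Longrightarrow> \<exists>f. bounded_compactly_supported f \<and>
      (\<forall>x. cmod (f x $ 1) \<le> indicator {- (2 * 2 powi n)..2 * 2 powi n} x) \<and> (\<forall>x. f x $ 2 = 0) \<and>
      (AE x in lebesgue. x \<in> {2 powi n / 2..<2 powi n} \<longrightarrow> c \<le> cmod (T f x $ 2))"
  shows "\<not> bounded_on_L2W (power_weight \<alpha>) T"
proof
  assume "bounded_on_L2W (power_weight \<alpha>) T"
  then obtain C where C: "\<And>f. bounded_compactly_supported f \<Longrightarrow>
      L2W_norm_sq (power_weight \<alpha>) (T f) \<le> ennreal (C\<^sup>2) * L2W_norm_sq (power_weight \<alpha>) f"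
    unfolding bounded_on_L2W_def by blast
  have ne0: "AE x in lebesgue. x \<noteq> (0::real)"
    by (rule AE_I'[of "{0}"]) auto
  define K where "K = 8 * C\<^sup>2 * 2 powr \<alpha>"
  have K: "0 \<le> K"
    by (simp add: K_def)
  have key: "c\<^sup>2 \<le> K * (2 powi n) powr (2 * \<alpha>)" if n: "odd n" for n :: int
  proof -
    define \<delta> :: real where "\<delta> = 2 powi n"
    have \<delta>: "0 < \<delta>"
      by (simp add: \<delta>_def)
    obtain f where f: "bounded_compactly_supported f"
      and f1: "\<And>x. cmod (f x $ 1) \<le> indicator {- (2 * \<delta>)..2 * \<delta>} x" and f2: "\<And>x. f x $ 2 = 0"
      and Tf: "AE x in lebesgue. x \<in> {\<delta> / 2..<\<delta>} \<longrightarrow> c \<le> cmod (T f x $ 2)"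
      using test[OF n] unfolding \<delta>_def by blast
    have "L2W_norm_sq (power_weight \<alpha>) f
        \<le> (\<integral>\<^sup>+x. ennreal ((2 * \<delta>) powr \<alpha>) * indicator {- (2 * \<delta>)..2 * \<delta>} x \<partial>lebesgue)"
      unfolding L2W_norm_sq_def L2_norm_sq_def
    proof (rule nn_integral_mono_AE, use ne0 in eventually_elim)
      fix x :: real assume "x \<noteq> 0"
      show "ennreal ((norm (matrix_sqrt (power_weight \<alpha> x) *v f x))\<^sup>2)
        \<le> ennreal ((2 * \<delta>) powr \<alpha>) * indicator {- (2 * \<delta>)..2 * \<delta>} x"
      proof (cases "x \<in> {- (2 * \<delta>)..2 * \<delta>}")
        case True
        then have "\<bar>x\<bar> powr \<alpha> \<le> (2 * \<delta>) powr \<alpha>"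
          using \<open>0 < \<alpha>\<close> by (intro powr_mono2) auto
        moreover have "(cmod (f x $ 1))\<^sup>2 \<le> 1"
          using f1[of x] True by (simp add: power_le_one)
        ultimately have "\<bar>x\<bar> powr \<alpha> * (cmod (f x $ 1))\<^sup>2 \<le> (2 * \<delta>) powr \<alpha> * 1"
          by (intro mult_mono) auto
        then show ?thesis
          using True \<open>x \<noteq> 0\<close> f2[of x] by (simp add: norm_weighted)
      next
        case False
        then show ?thesis
          using \<open>x \<noteq> 0\<close> f1[of x] f2[of x] by (simp add: norm_weighted)
      qed
    qed
    also have "\<dots> = ennreal ((2 * \<delta>) powr \<alpha> * (4 * \<delta>))"
      using \<delta> by (simp add: nn_integral_cmult_indicator ennreal_mult)
    finally have upper: "L2W_norm_sq (power_weight \<alpha>) f \<le> ennreal ((2 * \<delta>) powr \<alpha> * (4 * \<delta>))" .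
    have "ennreal (\<delta> powr (- \<alpha>) * c\<^sup>2 * (\<delta> / 2)) = ennreal (\<delta> powr (- \<alpha>) * c\<^sup>2) * ennreal (\<delta> / 2)"
      using \<delta> by (intro ennreal_mult) auto
    also have "ennreal (\<delta> / 2) = emeasure lebesgue {\<delta> / 2..<\<delta>}"
      using \<delta> by simp
    also have "ennreal (\<delta> powr (- \<alpha>) * c\<^sup>2) * emeasure lebesgue {\<delta> / 2..<\<delta>}
        = (\<integral>\<^sup>+x. ennreal (\<delta> powr (- \<alpha>) * c\<^sup>2) * indicator {\<delta> / 2..<\<delta>} x \<partial>lebesgue)"
      by (rule nn_integral_cmult_indicator[symmetric]) simp
    also have "\<dots> \<le> L2W_norm_sq (power_weight \<alpha>) (T f)"
      unfolding L2W_norm_sq_def L2_norm_sq_def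
    proof (rule nn_integral_mono_AE, use ne0 Tf in eventually_elim)
      fix x :: real assume "x \<noteq> 0" and Tfx: "x \<in> {\<delta> / 2..<\<delta>} \<longrightarrow> c \<le> cmod (T f x $ 2)"
      show "ennreal (\<delta> powr (- \<alpha>) * c\<^sup>2) * indicator {\<delta> / 2..<\<delta>} x
        \<le> ennreal ((norm (matrix_sqrt (power_weight \<alpha> x) *v T f x))\<^sup>2)"
      proof (cases "x \<in> {\<delta> / 2..<\<delta>}")
        case True
        have "\<delta> powr (- \<alpha>) \<le> \<bar>x\<bar> powr (- \<alpha>)"
          using True \<delta> \<open>0 < \<alpha>\<close> by (intro powr_mono2') auto
        moreover have "c\<^sup>2 \<le> (cmod (T f x $ 2))\<^sup>2"
          using Tfx True \<open>0 < c\<close> by (intro power_mono) auto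
        ultimately have "\<delta> powr (- \<alpha>) * c\<^sup>2 \<le> \<bar>x\<bar> powr (- \<alpha>) * (cmod (T f x $ 2))\<^sup>2"
          by (intro mult_mono) auto
        also have "\<dots> \<le> (norm (matrix_sqrt (power_weight \<alpha> x) *v T f x))\<^sup>2"
          using \<open>x \<noteq> 0\<close> by (simp add: norm_weighted)
        finally show ?thesis
          using True by (simp add: ennreal_leI)
      qed simp
    qed
    also have "\<dots> \<le> ennreal (C\<^sup>2) * L2W_norm_sq (power_weight \<alpha>) f"
      by (rule C[OF f])
    also have "\<dots> \<le> ennreal (C\<^sup>2) * ennreal ((2 * \<delta>) powr \<alpha> * (4 * \<delta>))"
      by (intro mult_left_mono upper) simp
    also have "\<dots> = ennreal (C\<^sup>2 * ((2 * \<delta>) powr \<alpha> * (4 * \<delta>)))"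
      using \<delta> by (simp add: ennreal_mult)
    finally have "\<delta> powr (- \<alpha>) * c\<^sup>2 * (\<delta> / 2) \<le> C\<^sup>2 * ((2 * \<delta>) powr \<alpha> * (4 * \<delta>))"
      using \<delta> by (subst (asm) ennreal_le_iff) auto
    then have "\<delta> * (\<delta> powr (- \<alpha>) * c\<^sup>2) \<le> \<delta> * (8 * C\<^sup>2 * (2 * \<delta>) powr \<alpha>)"
      by (simp add: algebra_simps)
    then have "\<delta> powr (- \<alpha>) * c\<^sup>2 \<le> 8 * C\<^sup>2 * (2 * \<delta>) powr \<alpha>"
      using \<delta> by (rule mult_left_le_imp_le)
    then have "\<delta> powr \<alpha> * (\<delta> powr (- \<alpha>) * c\<^sup>2) \<le> \<delta> powr \<alpha> * (8 * C\<^sup>2 * (2 * \<delta>) powr \<alpha>)"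
      by (rule mult_left_mono) simp
    moreover have "\<delta> powr \<alpha> * (\<delta> powr (- \<alpha>) * c\<^sup>2) = c\<^sup>2"
      using \<delta> by (simp add: powr_minus)
    moreover have "\<delta> powr \<alpha> * (8 * C\<^sup>2 * (2 * \<delta>) powr \<alpha>) = K * \<delta> powr (2 * \<alpha>)"
    proof -
      have "\<delta> powr (2 * \<alpha>) = \<delta> powr \<alpha> * \<delta> powr \<alpha>"
        by (metis mult_2 powr_add)
      then show ?thesis
        using \<delta> by (simp add: K_def powr_mult)
    qed
    ultimately show ?thesis
      unfolding \<delta>_def[symmetric] by (simp only:)
  qed
  \<comment> \<open>For \<open>\<delta> \<le> \<epsilon>\<close> the right-hand side of \<open>key\<close> is at most \<open>K c\<^sup>2 / (K + 1) < c\<^sup>2\<close>.\<close>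
  define \<epsilon> where "\<epsilon> = (c\<^sup>2 / (K + 1)) powr (1 / (2 * \<alpha>))"
  have "0 < \<epsilon>"
    using K \<open>0 < c\<close> by (auto simp: \<epsilon>_def)
  then obtain N where N: "(1 / 2) ^ N < \<epsilon>"
    using real_arch_pow_inv[of \<epsilon> "1 / 2"] by auto
  define n :: int where "n = - (2 * int N + 1)"
  have "(2::real) powi n = (1 / 2) ^ (2 * N + 1)"
  proof -
    have "n = - int (2 * N + 1)"
      by (simp add: n_def)
    then show ?thesis
      by (simp only: power_int_minus power_int_of_nat) (simp add: power_one_over inverse_eq_divide)
  qed
  also have "\<dots> \<le> (1 / 2) ^ N"
    by (rule power_decreasing) auto
  finally have "(2::real) powi n < \<epsilon>"
    using N by linarith
  then have "(2 powi n) powr (2 * \<alpha>) \<le> \<epsilon> powr (2 * \<alpha>)"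
    using \<open>0 < \<alpha>\<close> by (intro powr_mono2) auto
  also have "\<dots> = c\<^sup>2 / (K + 1)"
    using K \<open>0 < \<alpha>\<close> \<open>0 < c\<close> by (simp add: \<epsilon>_def powr_powr)
  finally have "K * (2 powi n) powr (2 * \<alpha>) \<le> K * (c\<^sup>2 / (K + 1))"
    using K by (rule mult_left_mono)
  also have "\<dots> < c\<^sup>2"
    using K \<open>0 < c\<close> by (simp add: field_simps)
  finally show False
    using key[of n] by (simp add: n_def)
qed

section \<open>The symbol\<close>

text \<open>
  The parity of \<open>\<lfloor>log 2 x\<rfloor>\<close> makes the function invariant under dilation by 4, hence equally
  oscillating at all scales near the origin.
\<close>

definition stripes :: "real \<Rightarrow> real" where
  "stripes x = (if 0 < x \<and> even \<lfloor>log 2 x\<rfloor> then 1 else 0)"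

lemma stripes_bounds: "0 \<le> stripes x" "stripes x \<le> 1"
  by (auto simp: stripes_def)

lemma stripes_nonpos: "x \<le> 0 \<Longrightarrow> stripes x = 0"
  by (simp add: stripes_def)

lemma stripes_measurable [measurable]: "stripes \<in> borel_measurable borel"
  unfolding stripes_def by measurable

lemma stripes_eq:
  fixes j :: int
  assumes "2 powi j \<le> x" "x < 2 powi (j + 1)"
  shows "stripes x = (if even j then 1 else 0)"
proof -
  have "0 < x"
    using assms(1) by (meson less_le_trans zero_less_numeral zero_less_power_int)
  moreover have "\<lfloor>log 2 x\<rfloor> = j"
    using assms \<open>0 < x\<close> powr_real_of_int'[of 2 j] powr_real_of_int'[of 2 "j + 1"]
    by (subst floor_log_eq_powr_iff) auto
  ultimately show ?thesis
    by (simp add: stripes_def)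
qed

text \<open>
  The ratio of the endpoints \<open>m + 1\<close> and \<open>m\<close> is at most 2, and no power of 2 lies strictly between
  them, so the interval fits into a single shell.
\<close>

lemma stripes_const_on_dyadic:
  fixes k m :: int
  assumes "1 \<le> m"
  shows "\<exists>c. \<forall>x\<in>{2 powi (- k) * of_int m..<2 powi (- k) * (of_int m + 1)}. stripes x = c"
proof -
  have "1 \<le> nat m"
    using assms by simp
  then obtain N where "2 ^ N \<le> nat m" "nat m < 2 ^ (N + 1)"
    using ex_power_ivl1[OF order_refl] by blast
  then have "int (2 ^ N) \<le> m" "m + 1 \<le> int (2 ^ (N + 1))"
    using assms by linarith+
  then have "real_of_int (int (2 ^ N)) \<le> of_int m" "real_of_int (m + 1) \<le> of_int (int (2 ^ (N + 1)))"
    by (simp_all only: of_int_le_iff)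
  then have m: "2 ^ N \<le> real_of_int m" "real_of_int m + 1 \<le> 2 ^ (N + 1)"
    by simp_all
  have "stripes x = (if even (int N - k) then 1 else 0)"
    if x: "x \<in> {2 powi (- k) * of_int m..<2 powi (- k) * (of_int m + 1)}" for x
  proof (rule stripes_eq)
    have "2 powi (int N - k) = 2 powi (- k) * (2::real) ^ N"
      by (simp add: power_int_diff power_int_minus field_simps)
    also have "\<dots> \<le> 2 powi (- k) * of_int m"
      using m by (intro mult_left_mono) auto
    finally show "2 powi (int N - k) \<le> x"
      using x by simp
    have "x < 2 powi (- k) * (of_int m + 1)"
      using x by simp
    also have "\<dots> \<le> 2 powi (- k) * (2::real) ^ (N + 1)"
      using m by (intro mult_left_mono) auto
    also have "\<dots> = 2 powi (int N - k + 1)"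
      by (simp add: power_int_add power_int_diff power_int_minus field_simps)
    finally show "x < 2 powi (int N - k + 1)" .
  qed
  then show ?thesis
    by blast
qed

lemma bounded_measurable_BMO:
  fixes g :: "real \<Rightarrow> complex"
  assumes meas: "g \<in> borel_measurable lebesgue" and bound: "\<And>x. cmod (g x) \<le> K"
  shows "g \<in> BMO"
proof -
  have int: "set_integrable lebesgue {a..b} g" for a b
    unfolding set_integrable_def using meas bound
    by (intro integrableI_bounded_set_indicator[where B = K]) (auto simp: emeasure_lborel_Icc_eq)
  have "(LINT x:{a..b}|lebesgue. cmod (g x - average a b g)) / (b - a) \<le> 2 * K" if "a < b" for a b
  proof -
    have c: "set_integrable lebesgue {a..b} (\<lambda>x. d)" for d :: "'b::{banach, second_countable_topology}"
      unfolding set_integrable_def by (intro integrableI_bounded_set_indicator[where B = "norm d"])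
        (auto simp: emeasure_lborel_Icc_eq)
    have cI: "(LINT x:{a..b}|lebesgue. d) = d * (b - a)" for d :: real
      using \<open>a < b\<close> by (simp add: set_lebesgue_integral_def)
    have "cmod (LINT x:{a..b}|lebesgue. g x) \<le> (LINT x:{a..b}|lebesgue. cmod (g x))"
      using int by (rule set_integral_norm_bound)
    also have "\<dots> \<le> (LINT x:{a..b}|lebesgue. K)"
      using int c bound by (intro set_integral_mono set_integrable_norm) auto
    finally have avg: "cmod (average a b g) \<le> K"
      using \<open>a < b\<close> by (simp add: average_def norm_divide cI pos_divide_le_eq flip: of_real_diff)
    have "(LINT x:{a..b}|lebesgue. cmod (g x - average a b g)) \<le> (LINT x:{a..b}|lebesgue. 2 * K)"
    proof (rule set_integral_mono)
      show "set_integrable lebesgue {a..b} (\<lambda>x. cmod (g x - average a b g))"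
        by (intro set_integrable_norm set_integral_diff int c)
      show "cmod (g x - average a b g) \<le> 2 * K" for x
        using norm_triangle_ineq4[of "g x" "average a b g"] bound[of x] avg by linarith
    qed (rule c)
    then show ?thesis
      using \<open>a < b\<close> by (simp only: cI pos_divide_le_eq diff_gt_0_iff_gt)
  qed
  then show ?thesis
    using int by (auto simp: BMO_def locally_integrable_def)
qed

definition corner_symbol :: "real \<Rightarrow> complex^2^2" where
  "corner_symbol x = vector [vector [0, 0], vector [of_real (stripes x), 0]]"

lemma corner_symbol_nth [simp]:
  "corner_symbol x $ 1 $ 1 = 0" "corner_symbol x $ 1 $ 2 = 0"
  "corner_symbol x $ 2 $ 1 = of_real (stripes x)" "corner_symbol x $ 2 $ 2 = 0"
  by (simp_all add: corner_symbol_def)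

lemma corner_symbol_mult_vec [simp]:
  "(corner_symbol x *v v) $ 1 = 0" "(corner_symbol x *v v) $ 2 = of_real (stripes x) * v $ 1"
  by (simp_all add: matrix_vector_mult_def sum_2)

lemma borel_measurable_lebesgueI: "f \<in> borel_measurable borel \<Longrightarrow> f \<in> borel_measurable lebesgue"
  by (rule measurable_completion) simp

lemma corner_symbol_BMO: "(\<lambda>x. corner_symbol x $ i $ j) \<in> BMO"
proof -
  have "(\<lambda>x. complex_of_real (stripes x)) \<in> borel_measurable lebesgue"
    by (rule borel_measurable_lebesgueI) measurable
  then have "(\<lambda>x. complex_of_real (stripes x)) \<in> BMO"
    using stripes_bounds by (intro bounded_measurable_BMO[where K = 1]) auto
  moreover have "(\<lambda>x. 0) \<in> BMO"
    by (rule bounded_measurable_BMO[where K = 0]) auto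
  ultimately show ?thesis
    using exhaust_2[of i] exhaust_2[of j] by auto
qed

lemma bounded_compactly_supported_scaleR:
  fixes s :: "real \<Rightarrow> real" and v :: "complex^'n"
  assumes s: "s \<in> borel_measurable borel" and bound: "\<And>x. \<bar>s x\<bar> \<le> indicator {- R..R} x"
  shows "bounded_compactly_supported (\<lambda>x. s x *\<^sub>R v)"
  unfolding bounded_compactly_supported_def compact_closure
proof (intro conjI)
  show "(\<lambda>x. s x *\<^sub>R v) \<in> borel_measurable lebesgue"
    by (rule borel_measurable_lebesgueI) (use s in measurable)
  have "\<bar>s x\<bar> \<le> 1" for x
    using bound[of x] by (rule order_trans) (rule indicator_le_1)
  then have "norm (s x *\<^sub>R v) \<le> norm v" for x
    by (simp add: mult_left_le_one_le)
  then show "bounded (range (\<lambda>x. s x *\<^sub>R v))"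
    by (auto simp: bounded_iff)
  have "x \<in> {- R..R}" if "s x \<noteq> 0" for x
    using bound[of x] that by (cases "x \<in> {- R..R}") auto
  then have "{x. s x *\<^sub>R v \<noteq> 0} \<subseteq> {- R..R}"
    by auto
  then show "bounded {x. s x *\<^sub>R v \<noteq> 0}"
    using bounded_closed_interval bounded_subset by blast
qed

section \<open>The commutator with the Hilbert transform\<close>

text \<open>
  The symbol vanishes on the support \<open>[-\<delta>, 0)\<close> of the test function, so the commutator is
  \<open>- b H f\<close>.  For \<open>0 < x < \<delta>\<close> the kernel \<open>1 / (x - y)\<close> is at least \<open>1 / (2\<delta>)\<close> there, which gives
  \<open>H f x \<ge> 1 / (2\<pi>)\<close>.
\<close>

lemma commutator_unbounded:
  assumes "0 < \<alpha>"
  shows "\<not> bounded_on_L2W (power_weight \<alpha>) (commutator vec_hilbert_transform corner_symbol)"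
proof (rule not_bounded_on_L2W_power_weight[where c = "1 / (2 * pi)"])
  fix n :: int assume "odd n"
  define \<delta> :: real where "\<delta> = 2 powi n"
  have \<delta>: "0 < \<delta>"
    by (simp add: \<delta>_def)
  define f :: "real \<Rightarrow> complex^2" where "f x = indicator {- \<delta>..<0} x *\<^sub>R axis 1 1" for x
  have f1: "f x $ 1 = of_real (indicator {- \<delta>..<0} x)" for x
    by (simp add: f_def axis_def scaleR_conv_of_real[where 'a = complex])
  have f2: "f x $ 2 = 0" for x
    by (simp add: f_def axis_def)
  have "bounded_compactly_supported f"
    unfolding f_def using \<delta>
    by (intro bounded_compactly_supported_scaleR[where R = \<delta>]) (auto simp: indicator_def)
  moreover have "cmod (f x $ 1) \<le> indicator {- (2 * \<delta>)..2 * \<delta>} x" for x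
    using \<delta> by (auto simp: f1 indicator_def)
  moreover have "1 / (2 * pi) \<le> cmod (commutator vec_hilbert_transform corner_symbol f x $ 2)"
    if x: "x \<in> {\<delta> / 2..<\<delta>}" for x
  proof -
    have "0 < x" "x < \<delta>"
      using x \<delta> by auto
    have "stripes x = 1"
      using x \<open>odd n\<close> by (subst stripes_eq[of "n - 1"]) (auto simp: \<delta>_def power_int_diff)
    define J where "J = (LINT y|lebesgue. indicator {- \<delta>..<0} y / (x - y))"
    have int: "integrable lebesgue (\<lambda>y. indicator {- \<delta>..<0} y *\<^sub>R (1 / (x - y)))"
    proof (rule integrableI_bounded_set_indicator[where B = "1 / x"])
      show "(\<lambda>y. 1 / (x - y)) \<in> borel_measurable lebesgue"
        by (rule borel_measurable_lebesgueI) measurable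
      show "AE y in lebesgue. y \<in> {- \<delta>..<0} \<longrightarrow> norm (1 / (x - y)) \<le> 1 / x"
        using \<open>0 < x\<close> by (intro AE_I2) (auto simp: frac_le)
    qed (use \<delta> in auto)
    have "1 / 2 = (LINT y|lebesgue. indicator {- \<delta>..<0} y *\<^sub>R (1 / (2 * \<delta>)))"
      using \<delta> by simp
    also have "\<dots> \<le> (LINT y|lebesgue. indicator {- \<delta>..<0} y *\<^sub>R (1 / (x - y)))"
    proof (rule integral_mono[OF _ int])
      show "integrable lebesgue (\<lambda>y. indicator {- \<delta>..<0} y *\<^sub>R (1 / (2 * \<delta>)))"
        by (intro integrableI_bounded_set_indicator[where B = "1 / (2 * \<delta>)"]) (use \<delta> in auto)
      show "indicator {- \<delta>..<0} y *\<^sub>R (1 / (2 * \<delta>)) \<le> indicator {- \<delta>..<0} y *\<^sub>R (1 / (x - y))" for y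
        using \<open>0 < x\<close> \<open>x < \<delta>\<close> by (auto simp: indicator_def intro!: frac_le)
    qed
    finally have J: "1 / 2 \<le> J"
      by (simp add: J_def)
    \<comment> \<open>Points of the support are at distance at least \<open>x\<close> from \<open>x\<close>, so that truncation at
      \<open>\<epsilon> < x\<close> removes nothing.\<close>
    have trunc: "of_real (1 / pi) * (LINT y:{y. \<epsilon> < \<bar>x - y\<bar>}|lebesgue. f y $ 1 / of_real (x - y))
        = complex_of_real (J / pi)" if "\<epsilon> < x" for \<epsilon>
    proof -
      have "indicator {y. \<epsilon> < \<bar>x - y\<bar>} y *\<^sub>R (f y $ 1 / of_real (x - y))
          = complex_of_real (indicator {- \<delta>..<0} y / (x - y))" for y
        using that by (auto simp: f1 indicator_def)
      then show ?thesis
        by (simp only: set_lebesgue_integral_def J_def integral_complex_of_real) simp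
    qed
    have "eventually (\<lambda>\<epsilon>. of_real (1 / pi) * (LINT y:{y. \<epsilon> < \<bar>x - y\<bar>}|lebesgue. f y $ 1 / of_real (x - y))
        = complex_of_real (J / pi)) (at_right 0)"
      using \<open>0 < x\<close> trunc by (intro eventually_at_rightI[of 0 x]) auto
    then have "((\<lambda>\<epsilon>. of_real (1 / pi) * (LINT y:{y. \<epsilon> < \<bar>x - y\<bar>}|lebesgue. f y $ 1 / of_real (x - y)))
        \<longlongrightarrow> complex_of_real (J / pi)) (at_right 0)"
      by (rule tendsto_eventually)
    then have H: "hilbert_transform (\<lambda>y. f y $ 1) x = complex_of_real (J / pi)"
      unfolding hilbert_transform_def by (intro tendsto_Lim) auto
    have "(corner_symbol y *v f y) $ 2 = 0" for y
      by (cases "y < 0") (simp_all add: f1 stripes_nonpos)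
    then have "hilbert_transform (\<lambda>y. (corner_symbol y *v f y) $ 2) x = hilbert_transform (\<lambda>y. 0) x"
      by (simp only:)
    also have "\<dots> = 0"
      unfolding hilbert_transform_def by (intro tendsto_Lim) auto
    finally have "commutator vec_hilbert_transform corner_symbol f x $ 2 = - complex_of_real (J / pi)"
      using H \<open>stripes x = 1\<close> by (simp add: commutator_def vec_hilbert_transform_def)
    then show ?thesis
      using J divide_right_mono[OF J pi_ge_zero] by (simp add: norm_divide)
  qed
  ultimately show "\<exists>f. bounded_compactly_supported f \<and>
      (\<forall>x. cmod (f x $ 1) \<le> indicator {- (2 * 2 powi n)..2 * 2 powi n} x) \<and> (\<forall>x. f x $ 2 = 0) \<and>
      (AE x in lebesgue. x \<in> {2 powi n / 2..<2 powi n} \<longrightarrow>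
        1 / (2 * pi) \<le> cmod (commutator vec_hilbert_transform corner_symbol f x $ 2))"
    using f2 unfolding \<delta>_def[symmetric] by (intro exI[of _ f] conjI allI AE_I2 impI)
qed (use assms in auto)

section \<open>The dyadic paraproduct\<close>

lemma haar_measurable [measurable]: "haar a b \<in> borel_measurable borel"
  unfolding haar_def by measurable

lemma integral_haar_const:
  assumes "a < b" and g: "\<And>x. x \<in> {a..<b} \<Longrightarrow> g x = c"
  shows "(LINT x|lebesgue. g x * haar a b x) = 0"
proof -
  have "g x * haar a b x
      = c / sqrt (b - a) * (indicator {a..<(a + b) / 2} x - indicator {(a + b) / 2..<b} x)" for x
    using assms by (auto simp: haar_def indicator_def)
  moreover have "(LINT x|lebesgue. indicator {a..<(a + b) / 2} x - indicator {(a + b) / 2..<b} x) = (0::real)"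
    using \<open>a < b\<close> by (subst Bochner_Integration.integral_diff) (auto simp: field_simps)
  ultimately show ?thesis
    by simp
qed

lemma haar_coeff_corner_symbol [simp]:
  "(haar_coeff corner_symbol a b *v v) $ 1 = 0"
  "(haar_coeff corner_symbol a b *v v) $ 2 = of_real (LINT x|lebesgue. stripes x * haar a b x) * v $ 1"
  by (simp_all add: matrix_vector_mult_def sum_2 haar_coeff_def flip: of_real_mult)

text \<open>
  Since \<open>n\<close> is odd, the right half of \<open>[0, \<delta>)\<close>, with \<open>\<delta> = 2 powi n\<close>, is a shell on which the symbol is
  1, and the right half of the left half is one on which it is 0.  The integrals over the left
  and the right half therefore differ by at least \<open>\<delta> / 4\<close>.
\<close>

lemma haar_coeff_stripes_le:
  fixes n :: int
  assumes "odd n"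
  shows "(LINT x|lebesgue. stripes x * haar 0 (2 powi n) x) \<le> - sqrt (2 powi n) / 4"
proof -
  define \<delta> :: real where "\<delta> = 2 powi n"
  have \<delta>: "0 < \<delta>"
    by (simp add: \<delta>_def)
  have right: "stripes x = 1" if "\<delta> / 2 \<le> x" "x < \<delta>" for x
    using that \<open>odd n\<close> by (subst stripes_eq[of "n - 1"]) (auto simp: \<delta>_def power_int_diff)
  have mid: "stripes x = 0" if "\<delta> / 4 \<le> x" "x < \<delta> / 2" for x
    using that \<open>odd n\<close> by (subst stripes_eq[of "n - 2"])
      (auto simp: \<delta>_def power_int_diff power_int_add)
  have "(LINT x|lebesgue. stripes x * haar 0 \<delta> x)
      \<le> (LINT x|lebesgue. (indicator {0..<\<delta> / 4} x - indicator {\<delta> / 2..<\<delta>} x) / sqrt \<delta>)"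
  proof (rule integral_mono)
    have "integrable lebesgue (\<lambda>x. indicator {0..<\<delta>} x *\<^sub>R (stripes x * haar 0 \<delta> x))"
    proof (rule integrableI_bounded_set_indicator[where B = "1 / sqrt \<delta>"])
      show "(\<lambda>x. stripes x * haar 0 \<delta> x) \<in> borel_measurable lebesgue"
        by (rule borel_measurable_lebesgueI) measurable
      show "AE x in lebesgue. x \<in> {0..<\<delta>} \<longrightarrow> norm (stripes x * haar 0 \<delta> x) \<le> 1 / sqrt \<delta>"
        using \<delta> by (intro AE_I2) (auto simp: stripes_def haar_def indicator_def)
    qed (use \<delta> in auto)
    moreover have "indicator {0..<\<delta>} x *\<^sub>R (stripes x * haar 0 \<delta> x) = stripes x * haar 0 \<delta> x" for x
      using \<delta> by (auto simp: haar_def indicator_def)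
    ultimately show "integrable lebesgue (\<lambda>x. stripes x * haar 0 \<delta> x)"
      by (simp only:)
    show "integrable lebesgue (\<lambda>x. (indicator {0..<\<delta> / 4} x - indicator {\<delta> / 2..<\<delta>} x) / sqrt \<delta>)"
      using \<delta> by (intro integrable_divide Bochner_Integration.integrable_diff integrable_real_indicator) auto
    show "stripes x * haar 0 \<delta> x \<le> (indicator {0..<\<delta> / 4} x - indicator {\<delta> / 2..<\<delta>} x) / sqrt \<delta>" for x
      using \<delta> right[of x] mid[of x] stripes_bounds[of x]
      by (auto simp: haar_def indicator_def divide_simps)
  qed
  also have "\<dots> = (\<delta> / 4 - \<delta> / 2) / sqrt \<delta>"
    using \<delta> by simp
  also have "\<dots> = - sqrt \<delta> / 4"
    using \<delta> by (simp add: field_simps)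
  finally show ?thesis
    by (simp add: \<delta>_def)
qed

text \<open>
  All partial sums over sets containing the exceptional interval coincide, which gives both the existence
  of a sum and its uniqueness up to a null set, whichever representative is selected.
\<close>

lemma paraproduct_single_term:
  fixes B :: "real \<Rightarrow> complex^'n^'n"
  assumes I: "(a, b) \<in> dyadic_grid"
    and others: "\<And>a' b'. (a', b') \<in> dyadic_grid \<Longrightarrow> (a', b') \<noteq> (a, b) \<Longrightarrow>
      haar_coeff B a' b' *v vec_average a' b' f = 0"
  shows "AE x in lebesgue. paraproduct B f x = haar a b x *\<^sub>R (haar_coeff B a b *v vec_average a b f)"
proof -
  define P where "P x = haar a b x *\<^sub>R (haar_coeff B a b *v vec_average a b f)" for x
  have Pm: "P \<in> borel_measurable lebesgue"
    unfolding P_def by (rule borel_measurable_lebesgueI) measurable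
  have sum_eq: "(\<Sum>(a, b)\<in>F. haar a b x *\<^sub>R (haar_coeff B a b *v vec_average a b f)) = P x"
    if F: "finite F" "{(a, b)} \<subseteq> F" "F \<subseteq> dyadic_grid" for F x
  proof -
    have "(case I of (a, b) \<Rightarrow> haar a b x *\<^sub>R (haar_coeff B a b *v vec_average a b f)) = 0"
      if "I \<in> F - {(a, b)}" for I
      using that F(3) others[of "fst I" "snd I"] by (cases I) auto
    then have "(\<Sum>(a, b)\<in>F. haar a b x *\<^sub>R (haar_coeff B a b *v vec_average a b f))
        = (\<Sum>(a, b)\<in>{(a, b)}. haar a b x *\<^sub>R (haar_coeff B a b *v vec_average a b f))"
      using F by (intro sum.mono_neutral_right) blast+
    then show ?thesis
      by (simp add: P_def)
  qed
  have iff: "paraproduct_sums B f g \<longleftrightarrow> g \<in> borel_measurable lebesgue \<and> L2_norm_sq (\<lambda>x. g x - P x) = 0" for g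
  proof -
    have "eventually (\<lambda>F. L2_norm_sq (\<lambda>x. g x -
          (\<Sum>(a, b)\<in>F. haar a b x *\<^sub>R (haar_coeff B a b *v vec_average a b f)))
        = L2_norm_sq (\<lambda>x. g x - P x)) (finite_subsets_at_top dyadic_grid)"
      unfolding eventually_finite_subsets_at_top
      using I by (intro exI[of _ "{(a, b)}"]) (auto simp: sum_eq)
    then show ?thesis
      unfolding paraproduct_sums_def by (simp add: tendsto_cong tendsto_const_iff)
  qed
  have "paraproduct_sums B f P"
    using Pm by (simp add: iff L2_norm_sq_def)
  then have "paraproduct_sums B f (paraproduct B f)"
    unfolding paraproduct_def by (rule someI[of "paraproduct_sums B f"])
  then have m: "paraproduct B f \<in> borel_measurable lebesgue"
    and z: "(\<integral>\<^sup>+x. ennreal ((norm (paraproduct B f x - P x))\<^sup>2) \<partial>lebesgue) = 0"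
    by (auto simp: iff L2_norm_sq_def)
  have "(\<lambda>x. ennreal ((norm (paraproduct B f x - P x))\<^sup>2)) \<in> borel_measurable lebesgue"
    using m Pm by measurable
  then have "AE x in lebesgue. ennreal ((norm (paraproduct B f x - P x))\<^sup>2) = 0"
    using z by (simp add: nn_integral_0_iff_AE)
  then show ?thesis
    by eventually_elim (simp add: P_def)
qed

text \<open>
  The test function \<open>s\<close> is 1 on \<open>[\<delta>/2, \<delta>)\<close> and \<open>-1/2\<close> on \<open>[\<delta>, 2\<delta>)\<close>.  Every dyadic interval other than
  \<open>[0, \<delta>)\<close> contributes 0: intervals on the negative half line and \<open>[0, 2^j)\<close> with \<open>2^j \<noteq> \<delta>\<close>
  because the mean of \<open>s\<close> is zero, all others because the symbol is constant on them.
  On \<open>[0, \<delta>)\<close> the mean of \<open>s\<close> is \<open>1/2\<close> and the Haar coefficient has modulus at least \<open>sqrt \<delta> / 4\<close>.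
\<close>

lemma paraproduct_unbounded:
  assumes "0 < \<alpha>"
  shows "\<not> bounded_on_L2W (power_weight \<alpha>) (paraproduct corner_symbol)"
proof (rule not_bounded_on_L2W_power_weight[where c = "1 / 8"])
  fix n :: int assume "odd n"
  define \<delta> :: real where "\<delta> = 2 powi n"
  have \<delta>: "0 < \<delta>"
    by (simp add: \<delta>_def)
  define s :: "real \<Rightarrow> real" where "s x = indicator {\<delta> / 2..<\<delta>} x - indicator {\<delta>..<2 * \<delta>} x / 2" for x
  define f :: "real \<Rightarrow> complex^2" where "f x = s x *\<^sub>R axis 1 1" for x
  have f1: "f x $ 1 = of_real (s x)" for x
    by (simp add: f_def axis_def scaleR_conv_of_real[where 'a = complex])
  have f2: "f x $ 2 = 0" for x
    by (simp add: f_def axis_def)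
  have s_le: "\<bar>s x\<bar> \<le> indicator {- (2 * \<delta>)..2 * \<delta>} x" for x
    using \<delta> by (auto simp: s_def indicator_def)
  have bcs: "bounded_compactly_supported f"
    unfolding f_def by (rule bounded_compactly_supported_scaleR[OF _ s_le]) (unfold s_def, measurable)
  have avg: "vec_average a b f $ 1 = of_real ((LINT x:{a..b}|lebesgue. s x) / (b - a))" for a b
    by (simp add: vec_average_def average_def f1 set_integral_complex_of_real)
  have int_s: "(LINT x:{0..c}|lebesgue. s x)
      = measure lebesgue ({0..c} \<inter> {\<delta> / 2..<\<delta>}) - measure lebesgue ({0..c} \<inter> {\<delta>..<2 * \<delta>}) / 2" for c
  proof -
    have fin: "integrable lebesgue (indicator ({0..c} \<inter> {p..<q}) :: real \<Rightarrow> real)" for p q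
    proof (rule integrable_real_indicator)
      have "emeasure lborel ({0..c} \<inter> {p..<q}) < \<infinity>"
        by (rule emeasure_bounded_finite) (simp add: bounded_Int)
      then show "emeasure lebesgue ({0..c} \<inter> {p..<q}) < \<infinity>"
        by simp
    qed simp
    have "indicator {0..c} x *\<^sub>R s x
        = indicator ({0..c} \<inter> {\<delta> / 2..<\<delta>}) x - indicator ({0..c} \<inter> {\<delta>..<2 * \<delta>}) x / 2" for x
      by (auto simp: s_def indicator_def)
    then show ?thesis
      using fin by (simp add: set_lebesgue_integral_def)
  qed
  have others: "haar_coeff corner_symbol a b *v vec_average a b f = 0"
    if I: "(a, b) \<in> dyadic_grid" "(a, b) \<noteq> (0, \<delta>)" for a b
  proof -
    obtain k m :: int where a: "a = 2 powi (- k) * of_int m" and b: "b = 2 powi (- k) * (of_int m + 1)"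
      using I by (auto simp: dyadic_grid_def)
    have "a < b"
      by (simp add: a b)
    consider "m \<le> - 1" | "m = 0" | "1 \<le> m"
      by linarith
    then have "(LINT x|lebesgue. stripes x * haar a b x) = 0 \<or> vec_average a b f $ 1 = 0"
    proof cases
      case 1
      then have "b \<le> 0"
        unfolding b by (intro mult_nonneg_nonpos) auto
      then have "indicator {a..b} x *\<^sub>R s x = 0" for x
        using \<delta> by (auto simp: s_def indicator_def)
      then show ?thesis
        by (simp only: avg set_lebesgue_integral_def) simp
    next
      case 2
      then have "a = 0" and b': "b = 2 powi (- k)"
        by (simp_all add: a b)
      then have "b \<noteq> \<delta>"
        using I by auto
      then have "- k \<noteq> n"
        using b' by (auto simp: \<delta>_def)
      then consider "- k \<le> n - 1" | "n + 1 \<le> - k"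
        by linarith
      then have "(LINT x:{0..b}|lebesgue. s x) = 0"
      proof cases
        case 1
        then have "b \<le> 2 powi (n - 1)"
          unfolding b' by (intro power_int_increasing) auto
        then have "b \<le> \<delta> / 2"
          by (simp add: \<delta>_def power_int_diff)
        then have "{0..b} \<inter> {\<delta> / 2..<\<delta>} \<subseteq> {\<delta> / 2}" "{0..b} \<inter> {\<delta>..<2 * \<delta>} = {}"
          using \<delta> by auto
        then show ?thesis
          unfolding int_s by (auto dest: subset_singletonD)
      next
        case 2
        then have "2 powi (n + 1) \<le> b"
          unfolding b' by (intro power_int_increasing) auto
        then have "2 * \<delta> \<le> b"
          by (simp add: \<delta>_def power_int_add)
        then have "{0..b} \<inter> {\<delta> / 2..<\<delta>} = {\<delta> / 2..<\<delta>}" "{0..b} \<inter> {\<delta>..<2 * \<delta>} = {\<delta>..<2 * \<delta>}"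
          using \<delta> by auto
        then show ?thesis
          unfolding int_s using \<delta> by simp
      qed
      then show ?thesis
        by (simp add: avg \<open>a = 0\<close>)
    next
      case 3
      then obtain c where "\<And>x. x \<in> {a..<b} \<Longrightarrow> stripes x = c"
        using stripes_const_on_dyadic[of m k] unfolding a b by blast
      then show ?thesis
        using integral_haar_const[OF \<open>a < b\<close>] by blast
    qed
    then show ?thesis
      unfolding vec_eq_iff forall_2 by auto
  qed
  have "{0..\<delta>} \<inter> {\<delta> / 2..<\<delta>} = {\<delta> / 2..<\<delta>}" "{0..\<delta>} \<inter> {\<delta>..<2 * \<delta>} = {\<delta>}"
    using \<delta> by auto
  then have half: "vec_average 0 \<delta> f $ 1 = 1 / 2"
    using \<delta> by (simp add: avg int_s)
  have "(0, \<delta>) \<in> dyadic_grid"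
    unfolding dyadic_grid_def \<delta>_def mem_Collect_eq
    by (rule exI[of _ "- n"], rule exI[of _ 0]) simp
  from paraproduct_single_term[OF this others]
  have "AE x in lebesgue. paraproduct corner_symbol f x
      = haar 0 \<delta> x *\<^sub>R (haar_coeff corner_symbol 0 \<delta> *v vec_average 0 \<delta> f)"
    by blast
  then have "AE x in lebesgue. x \<in> {\<delta> / 2..<\<delta>} \<longrightarrow> 1 / 8 \<le> cmod (paraproduct corner_symbol f x $ 2)"
  proof eventually_elim
    case (elim x)
    show ?case
    proof
      assume x: "x \<in> {\<delta> / 2..<\<delta>}"
      define h where "h = (LINT x|lebesgue. stripes x * haar 0 \<delta> x)"
      have "sqrt \<delta> / 4 \<le> \<bar>h\<bar>"
        using haar_coeff_stripes_le[OF \<open>odd n\<close>] unfolding h_def \<delta>_def by linarith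
      moreover have "\<bar>haar 0 \<delta> x\<bar> = 1 / sqrt \<delta>"
        using x \<delta> by (simp add: haar_def)
      ultimately have "1 / sqrt \<delta> * (sqrt \<delta> / 4) \<le> \<bar>haar 0 \<delta> x\<bar> * \<bar>h\<bar>"
        using \<delta> by (intro mult_mono) auto
      moreover have "1 / sqrt \<delta> * (sqrt \<delta> / 4) = 1 / 4"
        using \<delta> by simp
      moreover have "cmod (paraproduct corner_symbol f x $ 2) = \<bar>haar 0 \<delta> x\<bar> * \<bar>h\<bar> / 2"
        by (simp add: elim half h_def norm_mult norm_divide)
      ultimately show "1 / 8 \<le> cmod (paraproduct corner_symbol f x $ 2)"
        by simp
    qed
  qed
  moreover have "cmod (f x $ 1) \<le> indicator {- (2 * \<delta>)..2 * \<delta>} x" for x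
    using s_le[of x] by (simp add: f1)
  ultimately show "\<exists>f. bounded_compactly_supported f \<and>
      (\<forall>x. cmod (f x $ 1) \<le> indicator {- (2 * 2 powi n)..2 * 2 powi n} x) \<and> (\<forall>x. f x $ 2 = 0) \<and>
      (AE x in lebesgue. x \<in> {2 powi n / 2..<2 powi n} \<longrightarrow>
        1 / 8 \<le> cmod (paraproduct corner_symbol f x $ 2))"
    using f2 bcs unfolding \<delta>_def[symmetric] by blast
qed (use assms in auto)

section \<open>The counterexample\<close>

theorem proposition4p2:
  fixes \<alpha> :: real
  assumes "0 < \<alpha>" and "\<alpha> < 1"
  shows "matrix_A2_weight (power_weight \<alpha>) \<and>
    (\<exists>B :: real \<Rightarrow> complex^2^2.
       (\<forall>i j. (\<lambda>x. B x $ i $ j) \<in> BMO) \<and>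
       \<not> bounded_on_L2W (power_weight \<alpha>) (paraproduct B) \<and>
       \<not> bounded_on_L2W (power_weight \<alpha>) (commutator vec_hilbert_transform B))"
  using matrix_A2_power_weight[OF assms] corner_symbol_BMO paraproduct_unbounded[OF assms(1)]
    commutator_unbounded[OF assms(1)] by blast

end
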